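(* Let $X_e=(X_1,X_2,X_3)\in\mathcal M$ be a configuration of three point vortices lying on a geodesic of the hyperboloid $\mathcal H_2$, with nonzero real vorticities $\Gamma_1,\Gamma_2,\Gamma_3$. Suppose $X_2$ lies between $X_1$ and $X_3$ on the geodesic, and let $L_{ij}=\langle X_i,X_j\rangle_{\mathcal H}^2-1$. Then $X_e$ is a relative equilibrium if and only if $$\sqrt{L_{23}}\,(L_{13}-L_{12})\,\Gamma_1+\sqrt{L_{13}}\,(L_{23}-L_{12})\,\Gamma_2+\sqrt{L_{12}}\,(L_{23}-L_{13})\,\Gamma_3=0.$$ Moreover, the momentum value $\mu=\Gamma_1X_1+\Gamma_2X_2+\Gamma_3X_3$ of a geodesic relative equilibrium is either zero or elliptic.
   Context: On $\mathbb{R}^3$ let $\langle X_1,X_2\rangle_{\mathcal H}=x_1x_2+y_1y_2-z_1z_2$ and $X_1\times_{\mathcal H}X_2=(y_1z_2-z_1y_2,\ z_1x_2-x_1z_2,\ -x_1y_2+y_1x_2)$. The hyperbolic plane is $\mathcal H_2=\{(x,y,z)\in\mathbb{R}^3\mid z^2-x^2-y^2=1,\ z>0\}$ with the metric $dx^2+dy^2-dz^2$; geodesics are the intersections of $\mathcal H_2$ with planes through the origin. The phase space is $\mathcal M=\mathcal H_2^3\setminus\Delta$, where $\Delta$ is the set of configurations in which two or more points coincide. The dynamics is $$\dot X_r=\frac1\pi\sum_{p\ne r}\Gamma_p\frac{X_p\times_{\mathcal H}X_r}{\langle X_r,X_p\rangle_{\mathcal H}^2-1},\qquad r=1,2,3.$$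 The group $SL(2,\mathbb{R})$ acts on $\mathbb{R}^3$ by conjugation $\rho\mapsto g\rho g^{-1}$ under the identification $(x,y,z)\leftrightarrow\begin{pmatrix} x & y+z \\ y-z & -x \end{pmatrix}$; this preserves $\mathcal H_2$ and acts diagonally on $\mathcal M$. A point $X_e\in\mathcal M$ is a relative equilibrium if the trajectory through $X_e$ is contained in the $SL(2,\mathbb{R})$-orbit of $X_e$; it is a geodesic relative equilibrium if moreover its points lie on a common geodesic. A momentum value $\mu=(x,y,z)\in\mathbb{R}^3$ is elliptic if $z^2-x^2-y^2>0$ (equivalently, $\mu\ne0$ and its isotropy subgroup in $SL(2,\mathbb{R})$ is conjugate to $SO(2)$). *)

theory Defs
  imports "HOL-Analysis.Analysis"
begin

definition hinner :: "real^3 \<Rightarrow> real^3 \<Rightarrow> real" where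
  "hinner X Y = X$1 * Y$1 + X$2 * Y$2 - X$3 * Y$3"

definition hcross :: "real^3 \<Rightarrow> real^3 \<Rightarrow> real^3" where
  "hcross X Y = vector [X$2 * Y$3 - X$3 * Y$2, X$3 * Y$1 - X$1 * Y$3, - (X$1 * Y$2) + X$2 * Y$1]"

definition hyp_plane :: "(real^3) set" where
  "hyp_plane = {X. (X$3)\<^sup>2 - (X$1)\<^sup>2 - (X$2)\<^sup>2 = 1 \<and> X$3 > 0}"

text \<open>The distance function of the Riemannian metric that \<^const>\<open>hinner\<close> induces on
  \<^const>\<open>hyp_plane\<close>.\<close>

definition hdist :: "real^3 \<Rightarrow> real^3 \<Rightarrow> real" where
  "hdist X Y = arcosh (- hinner X Y)"

definition geodesic :: "(real^3) set \<Rightarrow> bool" where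
  "geodesic G \<longleftrightarrow> (\<exists>P. subspace P \<and> dim P = 2 \<and> G = hyp_plane \<inter> P \<and> G \<noteq> {})"

text \<open>For points on a common geodesic, metric betweenness is betweenness along that geodesic.\<close>

definition hbetween :: "real^3 \<Rightarrow> real^3 \<Rightarrow> real^3 \<Rightarrow> bool" where
  "hbetween X Y Z \<longleftrightarrow> hdist X Z = hdist X Y + hdist Y Z"

text \<open>A configuration is a vector of three points, \<open>X $ r\<close> being the position of the vortex \<open>r\<close>.
  In the index type \<open>3\<close>, whose arithmetic is modulo 3, the elements are \<open>1\<close>, \<open>2\<close> and \<open>3 = 0\<close>.\<close>

definition phase_space :: "(real^3^3) set" where
  "phase_space = {X. (\<forall>r. X$r \<in> hyp_plane) \<and> (\<forall>r s. r \<noteq> s \<longrightarrow> X$r \<noteq> X$s)}"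

definition on_common_geodesic :: "real^3^3 \<Rightarrow> bool" where
  "on_common_geodesic X \<longleftrightarrow> (\<exists>G. geodesic G \<and> (\<forall>r. X$r \<in> G))"

definition vortex_field :: "real^3 \<Rightarrow> real^3^3 \<Rightarrow> real^3^3" where
  "vortex_field \<Gamma> X = (\<chi> r. (1 / pi) *\<^sub>R
     (\<Sum>p\<in>UNIV - {r}. \<Gamma>$p *\<^sub>R ((1 / ((hinner (X$r) (X$p))\<^sup>2 - 1)) *\<^sub>R hcross (X$p) (X$r))))"

definition vortex_solution :: "real^3 \<Rightarrow> real^3^3 \<Rightarrow> real set \<Rightarrow> (real \<Rightarrow> real^3^3) \<Rightarrow> bool" where
  "vortex_solution \<Gamma> X0 I \<phi> \<longleftrightarrow>
     open I \<and> is_interval I \<and> 0 \<in> I \<and> \<phi> 0 = X0 \<and>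
     (\<forall>t\<in>I. \<phi> t \<in> phase_space \<and> (\<phi> has_vector_derivative vortex_field \<Gamma> (\<phi> t)) (at t))"

text \<open>Maximal solutions. The field is smooth on \<^const>\<open>phase_space\<close>, so for each \<open>X0\<close> there the
  interval \<open>I\<close> and the values of \<open>\<phi>\<close> on it are uniquely determined.\<close>

definition vortex_trajectory :: "real^3 \<Rightarrow> real^3^3 \<Rightarrow> real set \<Rightarrow> (real \<Rightarrow> real^3^3) \<Rightarrow> bool" where
  "vortex_trajectory \<Gamma> X0 I \<phi> \<longleftrightarrow>
     vortex_solution \<Gamma> X0 I \<phi> \<and>
     (\<forall>J \<psi>. vortex_solution \<Gamma> X0 J \<psi> \<and> I \<subseteq> J \<and> (\<forall>t\<in>I. \<psi> t = \<phi> t) \<longrightarrow> J = I)"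

definition to_mat :: "real^3 \<Rightarrow> real^2^2" where
  "to_mat X = vector [vector [X$1, X$2 + X$3], vector [X$2 - X$3, - X$1]]"

text \<open>The inverse of \<^const>\<open>to_mat\<close> on trace-free matrices.\<close>

definition of_mat :: "real^2^2 \<Rightarrow> real^3" where
  "of_mat A = vector [A$1$1, (A$1$2 + A$2$1) / 2, (A$1$2 - A$2$1) / 2]"

definition SL2 :: "(real^2^2) set" where
  "SL2 = {g. det g = 1}"

definition sl2_act :: "real^2^2 \<Rightarrow> real^3 \<Rightarrow> real^3" where
  "sl2_act g X = of_mat (g ** to_mat X ** matrix_inv g)"

definition sl2_orbit :: "real^3^3 \<Rightarrow> (real^3^3) set" where
  "sl2_orbit X = (\<lambda>g. \<chi> r. sl2_act g (X$r)) ` SL2"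

definition relative_equilibrium :: "real^3 \<Rightarrow> real^3^3 \<Rightarrow> bool" where
  "relative_equilibrium \<Gamma> X \<longleftrightarrow>
     X \<in> phase_space \<and> (\<exists>I \<phi>. vortex_trajectory \<Gamma> X I \<phi> \<and> \<phi> ` I \<subseteq> sl2_orbit X)"

definition geodesic_relative_equilibrium :: "real^3 \<Rightarrow> real^3^3 \<Rightarrow> bool" where
  "geodesic_relative_equilibrium \<Gamma> X \<longleftrightarrow> relative_equilibrium \<Gamma> X \<and> on_common_geodesic X"

definition momentum :: "real^3 \<Rightarrow> real^3^3 \<Rightarrow> real^3" where
  "momentum \<Gamma> X = (\<Sum>r\<in>UNIV. \<Gamma>$r *\<^sub>R X$r)"

definition elliptic :: "real^3 \<Rightarrow> bool" where
  "elliptic \<mu> \<longleftrightarrow> (\<mu>$3)\<^sup>2 - (\<mu>$1)\<^sup>2 - (\<mu>$2)\<^sup>2 > 0"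

definition L :: "real^3^3 \<Rightarrow> 3 \<Rightarrow> 3 \<Rightarrow> real" where
  "L X i j = (hinner (X$i) (X$j))\<^sup>2 - 1"

end

(* In coordinates X_r = cosh t_r e0 + sinh t_r e1 on the geodesic, every vortex moves along the
   normal N = e0 x e1 of its plane, with speed a_r / pi where
   a_r = sum of Gamma_p / sinh (t_r - t_p) over p different from r.

   A trajectory inside the orbit keeps the triple product <X_1 x X_2, X_3> equal to 0. Its derivative
   at time 0 is a multiple of
     a_1 sinh (t_3 - t_2) + a_2 sinh (t_1 - t_3) + a_3 sinh (t_2 - t_1),
   which is the stated condition up to a nonzero factor. Conversely, if this vanishes then
   a_r = alpha sinh t_r + beta cosh t_r, so the field at X_e is X_r |-> xi x X_r for one vector xi, and
   by equivariance the one-parameter group generated by xi carries X_e along a global solution.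

   For the momentum, order the points along the geodesic and eliminate the middle one: mu = p X_1 + q X_3,
   and the condition becomes p sqrt L_23 (L_13 - L_12) = q sqrt L_12 (L_13 - L_23). Both factors are
   positive, so p and q have the same sign and mu is zero or timelike. *)

theory Submission
  imports Defs
begin

section \<open>Algebra of the Lorentzian inner and cross products\<close>

lemma hcross_nth [simp]:
  "hcross X Y $ 1 = X$2 * Y$3 - X$3 * Y$2"
  "hcross X Y $ 2 = X$3 * Y$1 - X$1 * Y$3"
  "hcross X Y $ 3 = X$2 * Y$1 - X$1 * Y$2"
  by (simp_all add: hcross_def)

lemma vec3_eqI: "X = Y" if "X$1 = Y$1" "X$2 = Y$2" "X$3 = Y$3" for X Y :: "'a^3"
  using that by (simp add: vec_eq_iff forall_3)

lemma bilinear_hinner: "bilinear hinner"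
  by (auto simp: bilinear_def hinner_def algebra_simps intro!: linearI)

lemma bilinear_hcross: "bilinear hcross"
  by (auto simp: bilinear_def algebra_simps intro!: linearI vec3_eqI)

lemma hcross_self [simp]: "hcross X X = 0"
  by (simp add: vec3_eqI)

lemma hcross_swap: "hcross Y X = - hcross X Y"
  by (simp add: vec3_eqI)

lemma hinner_commute: "hinner X Y = hinner Y X"
  by (simp add: hinner_def)

text \<open>Lagrange's identity with the sign opposite to the Euclidean one. The normal of a plane
  with an orthonormal basis of one timelike and one spacelike vector is thus a spacelike unit
  vector.\<close>

lemma hinner_hcross_hcross: "hinner (hcross X Y) (hcross X Y) = (hinner X Y)\<^sup>2 - hinner X X * hinner Y Y"
  unfolding hinner_def hcross_nth by algebra

text \<open>Cayley-Hamilton for the operator A = \<open>hcross \<xi>\<close>. It makes exp(tA) a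
  quadratic polynomial in A.\<close>

lemma hcross_rodrigues:
  "hcross \<xi> (hcross \<xi> (hcross \<xi> X)) = hinner \<xi> \<xi> *\<^sub>R hcross \<xi> X"
  by (intro vec3_eqI) (simp_all add: hinner_def algebra_simps)

section \<open>The conjugation action of SL(2,R) and its invariants\<close>

lemma matrix_inv_SL2:
  assumes "g \<in> SL2"
  shows "matrix_inv g = vector [vector [g$2$2, - g$1$2], vector [- g$2$1, g$1$1]]" (is "_ = ?h")
proof -
  have "g$1$1 * g$2$2 - g$1$2 * g$2$1 = 1"
    using assms by (simp add: SL2_def det_2)
  then have h: "g ** ?h = mat 1" "?h ** g = mat 1"
    by (simp_all add: vec_eq_iff forall_2 matrix_matrix_mult_def sum_2 mat_def algebra_simps)
  \<comment> \<open>\<open>matrix_inv\<close> is a choice among two-sided inverses. The adjugate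
    \<open>?h\<close> shows that one exists, and then that the chosen one is
    \<open>?h\<close>.\<close>
  have "g ** matrix_inv g = mat 1"
    unfolding matrix_inv_def by (rule someI2[of _ ?h]) (use h in auto)
  then have "(?h ** g) ** matrix_inv g = ?h"
    unfolding matrix_mul_assoc[symmetric] by (simp only: matrix_mul_rid)
  then show ?thesis
    by (simp only: h(2) matrix_mul_lid)
qed

lemma sl2_act_nth:
  assumes "g \<in> SL2"
  shows "sl2_act g X $ 1 = (g$1$1 * g$2$2 + g$1$2 * g$2$1) * X$1 - g$1$1 * g$2$1 * (X$2 + X$3)
           + g$1$2 * g$2$2 * (X$2 - X$3)"
    and "sl2_act g X $ 2 = (g$2$1 * g$2$2 - g$1$1 * g$1$2) * X$1 + ((g$1$1)\<^sup>2 - (g$2$1)\<^sup>2) / 2 * (X$2 + X$3)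
           + ((g$2$2)\<^sup>2 - (g$1$2)\<^sup>2) / 2 * (X$2 - X$3)"
    and "sl2_act g X $ 3 = - (g$1$1 * g$1$2 + g$2$1 * g$2$2) * X$1 + ((g$1$1)\<^sup>2 + (g$2$1)\<^sup>2) / 2 * (X$2 + X$3)
           - ((g$1$2)\<^sup>2 + (g$2$2)\<^sup>2) / 2 * (X$2 - X$3)"
  by (simp_all add: sl2_act_def matrix_inv_SL2[OF assms] of_mat_def to_mat_def
      matrix_matrix_mult_def sum_2 field_simps power2_eq_square)

lemma linear_sl2_act: "linear (sl2_act g)" if "g \<in> SL2"
  by (rule linearI; rule vec3_eqI) (simp_all add: sl2_act_nth[OF that] field_simps)

text \<open>\<open>- hinner X X\<close> is the determinant of \<open>to_mat X\<close>, hence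
  invariant under conjugation. In coordinates the identity carries the factor (det g)^2.\<close>

lemma hinner_sl2_act:
  assumes "g \<in> SL2"
  shows "hinner (sl2_act g X) (sl2_act g Y) = hinner X Y"
proof -
  have "hinner (sl2_act g X) (sl2_act g Y) = (g$1$1 * g$2$2 - g$1$2 * g$2$1)\<^sup>2 * hinner X Y"
    unfolding hinner_def sl2_act_nth[OF assms]
    by (simp add: add_divide_distrib diff_divide_distrib algebra_simps power2_eq_square)
  then show ?thesis
    using assms by (simp add: SL2_def det_2)
qed

text \<open>Conjugation respects commutators, and the commutator of \<open>to_mat X\<close> and
  \<open>to_mat Y\<close> is -2 times \<open>to_mat (hcross X Y)\<close>.\<close>

lemma hcross_sl2_act:
  assumes "g \<in> SL2"
  shows "hcross (sl2_act g X) (sl2_act g Y) = sl2_act g (hcross X Y)"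
proof -
  have "hcross (sl2_act g X) (sl2_act g Y) = (g$1$1 * g$2$2 - g$1$2 * g$2$1) *\<^sub>R sl2_act g (hcross X Y)"
    by (rule vec3_eqI; simp add: sl2_act_nth[OF assms])
      (simp_all add: field_simps power2_eq_square)
  then show ?thesis
    using assms by (simp add: SL2_def det_2)
qed

text \<open>Since the form is preserved, the only question is whether the upper sheet could be sent
  to the lower one.\<close>

lemma sl2_act_hyp_plane:
  assumes g: "g \<in> SL2" and X: "X \<in> hyp_plane"
  shows "sl2_act g X \<in> hyp_plane"
proof -
  have det: "g$1$1 * g$2$2 - g$1$2 * g$2$1 = 1"
    using g by (simp add: SL2_def det_2)
  define a b where "a = X$3 + X$2" and "b = X$3 - X$2"
  have ab: "a * b = 1 + (X$1)\<^sup>2" and "a + b > 0"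
    using X by (auto simp: hyp_plane_def a_def b_def algebra_simps power2_eq_square)
  then have a: "a > 0"
    by (smt (verit) mult_nonneg_nonpos2 zero_le_power2 mult_nonpos_nonneg mult_nonpos_nonpos)
  \<comment> \<open>In the light-cone coordinates \<open>a\<close> and \<open>b\<close>, multiplying
    by \<open>a\<close> and using \<open>a * b = 1 + (X$1)\<^sup>2\<close> completes the squares.
    The last two squares form the second column of \<open>g\<close>, which is nonzero.\<close>
  have "a * (2 * sl2_act g X $ 3) =
      (a * g$1$1 - X$1 * g$1$2)\<^sup>2 + (a * g$2$1 - X$1 * g$2$2)\<^sup>2 + (g$1$2)\<^sup>2 + (g$2$2)\<^sup>2"
    using ab unfolding sl2_act_nth[OF g] a_def b_def by (simp add: field_simps) algebra
  moreover have "(g$1$2)\<^sup>2 + (g$2$2)\<^sup>2 > 0"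
    using det by (auto simp: sum_power2_gt_zero_iff)
  ultimately have "a * (2 * sl2_act g X $ 3) > 0"
    by (smt (verit) zero_le_power2)
  with a have "sl2_act g X $ 3 > 0"
    by (simp add: zero_less_mult_iff)
  with hinner_sl2_act[OF g, of X X] X show ?thesis
    by (simp add: hyp_plane_def hinner_def power2_eq_square)
qed

text \<open>An isometry of a nondegenerate form has trivial kernel.\<close>

lemma inj_sl2_act:
  assumes "g \<in> SL2"
  shows "inj (sl2_act g)"
proof (rule linear_injective_0[THEN iffD2, OF linear_sl2_act[OF assms], rule_format])
  fix X assume 0: "sl2_act g X = 0"
  have "hinner X Y = 0" for Y
    using hinner_sl2_act[OF assms, of X Y] by (simp add: 0 hinner_def)
  from this[of "axis 1 1"] this[of "axis 2 1"] this[of "axis 3 1"] show "X = 0"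
    by (simp add: hinner_def axis_def vec3_eqI)
qed

lemma sl2_act_phase_space:
  assumes "g \<in> SL2" "X \<in> phase_space"
  shows "(\<chi> r. sl2_act g (X$r)) \<in> phase_space"
  using assms inj_sl2_act[OF assms(1)]
  by (auto simp: phase_space_def sl2_act_hyp_plane dest: injD)

lemma vortex_field_sl2_act:
  assumes "g \<in> SL2"
  shows "vortex_field \<Gamma> (\<chi> r. sl2_act g (X$r)) = (\<chi> r. sl2_act g (vortex_field \<Gamma> X $ r))"
  by (simp add: vortex_field_def hinner_sl2_act hcross_sl2_act linear_sl2_act assms
      linear_scale linear_sum)

section \<open>One-parameter subgroups of SL(2,R)\<close>

lemma generator_coefficients:
  fixes d :: real
  obtains c s :: "real \<Rightarrow> real"
  where "\<And>t. (c has_real_derivative - d * s t) (at t)" "\<And>t. (s has_real_derivative c t) (at t)"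
    "c 0 = 1" "s 0 = 0" "\<And>t. (c t)\<^sup>2 + d * (s t)\<^sup>2 = 1"
proof -
  \<comment> \<open>Generalised cosine and sine. With \<open>d\<close> equal to minus a quarter of
    \<open>hinner \<xi> \<xi>\<close>, the three cases are the elliptic, hyperbolic and parabolic
    (or trivial) subgroups.\<close>
  consider (pos) w where "w \<noteq> 0" "d = w\<^sup>2" | (neg) w where "w \<noteq> 0" "d = - w\<^sup>2" | (zero) "d = 0"
    by (metis abs_of_nonneg abs_of_nonpos linorder_linear minus_minus power_zero_numeral real_sqrt_abs
        real_sqrt_pow2_iff abs_ge_zero real_sqrt_eq_zero_cancel_iff)
  then show thesis
  proof cases
    case pos
    then show ?thesis
      by (intro that[of "\<lambda>t. cos (w * t)" "\<lambda>t. sin (w * t) / w"])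
        (auto intro!: derivative_eq_intros simp: power2_eq_square field_simps simp flip: power2_eq_square)
  next
    case neg
    then show ?thesis
      by (intro that[of "\<lambda>t. cosh (w * t)" "\<lambda>t. sinh (w * t) / w"])
        (auto intro!: derivative_eq_intros simp: cosh_square_eq power2_eq_square field_simps simp flip: power2_eq_square)
  next
    case zero
    then show ?thesis
      by (intro that[of "\<lambda>_. 1" "\<lambda>t. t"]) (auto intro!: derivative_eq_intros)
  qed
qed

text \<open>Rodrigues' formula. The square of \<open>to_mat \<xi>\<close> is
  \<open>hinner \<xi> \<xi>\<close> times the identity, so for the generalised cosine and sine at
  time t the matrix \<open>g\<close> is exp(-t/2 M) with M = \<open>to_mat \<xi>\<close>.
  Conjugation by it is exp(tA) with A = \<open>hcross \<xi>\<close>.\<close>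

lemma rodrigues_sl2_act:
  assumes cs: "c\<^sup>2 - hinner \<xi> \<xi> / 4 * s\<^sup>2 = 1"
  defines "g \<equiv> c *\<^sub>R mat 1 - (s / 2) *\<^sub>R to_mat \<xi>"
  shows "g \<in> SL2"
    and "sl2_act g X = X + (c * s) *\<^sub>R hcross \<xi> X + (s\<^sup>2 / 2) *\<^sub>R hcross \<xi> (hcross \<xi> X)"
proof -
  have nth: "g$1$1 = c - s / 2 * \<xi>$1" "g$1$2 = - s / 2 * (\<xi>$2 + \<xi>$3)"
    "g$2$1 = - s / 2 * (\<xi>$2 - \<xi>$3)" "g$2$2 = c + s / 2 * \<xi>$1"
    by (simp_all add: g_def mat_def to_mat_def)
  show g: "g \<in> SL2"
    using cs by (simp add: SL2_def det_2 nth hinner_def power2_eq_square field_simps)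
  have c2: "c\<^sup>2 = 1 + ((\<xi>$1)\<^sup>2 + (\<xi>$2)\<^sup>2 - (\<xi>$3)\<^sup>2) / 4 * s\<^sup>2"
    using cs by (simp add: hinner_def power2_eq_square)
  show "sl2_act g X = X + (c * s) *\<^sub>R hcross \<xi> X + (s\<^sup>2 / 2) *\<^sub>R hcross \<xi> (hcross \<xi> X)"
    apply (rule vec3_eqI)
    unfolding sl2_act_nth[OF g] nth vector_add_component vector_scaleR_component hcross_nth
    using c2 by (simp_all add: field_simps; algebra)+
qed

lemmas hinner_bilinear_simps =
  bilinear_ladd[OF bilinear_hinner] bilinear_radd[OF bilinear_hinner]
  bilinear_lmul[OF bilinear_hinner] bilinear_rmul[OF bilinear_hinner]

lemmas hcross_bilinear_simps =
  bilinear_ladd[OF bilinear_hcross] bilinear_radd[OF bilinear_hcross]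
  bilinear_lmul[OF bilinear_hcross] bilinear_rmul[OF bilinear_hcross]

section \<open>Scalar form of the equilibrium condition\<close>

definition normal_speed :: "real^3 \<Rightarrow> (3 \<Rightarrow> real) \<Rightarrow> 3 \<Rightarrow> real" where
  "normal_speed \<Gamma> \<theta> r = (\<Sum>p\<in>UNIV - {r}. \<Gamma>$p / sinh (\<theta> r - \<theta> p))"

text \<open>The determinant with rows (a_r, cosh t_r, sinh t_r), expanded along its first column. It
  detects whether the normal speeds a_r come from a rigid motion.\<close>

definition defect :: "real^3 \<Rightarrow> (3 \<Rightarrow> real) \<Rightarrow> real" where
  "defect \<Gamma> \<theta> = normal_speed \<Gamma> \<theta> 1 * sinh (\<theta> 3 - \<theta> 2) + normal_speed \<Gamma> \<theta> 2 * sinh (\<theta> 1 - \<theta> 3)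
     + normal_speed \<Gamma> \<theta> 3 * sinh (\<theta> 2 - \<theta> 1)"

lemma UNIV_3_diff: "UNIV - {1} = {2, 3::3}" "UNIV - {2} = {1, 3::3}" "UNIV - {3} = {1, 2::3}"
  unfolding UNIV_3 by auto

lemma sinh_diff_swap: "sinh (y - x) = - sinh (x - y)" for x y :: real
  by (simp flip: sinh_minus)

lemma normal_speed_3:
  "normal_speed \<Gamma> \<theta> 1 = - \<Gamma>$2 / sinh (\<theta> 2 - \<theta> 1) - \<Gamma>$3 / sinh (\<theta> 3 - \<theta> 1)"
  "normal_speed \<Gamma> \<theta> 2 = \<Gamma>$1 / sinh (\<theta> 2 - \<theta> 1) - \<Gamma>$3 / sinh (\<theta> 3 - \<theta> 2)"
  "normal_speed \<Gamma> \<theta> 3 = \<Gamma>$1 / sinh (\<theta> 3 - \<theta> 1) + \<Gamma>$2 / sinh (\<theta> 3 - \<theta> 2)"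
  by (simp_all add: normal_speed_def UNIV_3_diff sinh_diff_swap[of "\<theta> 1"] sinh_diff_swap[of "\<theta> 2" "\<theta> 3"])

lemma defect_eq_0_iff:
  assumes "\<theta> 1 \<noteq> \<theta> 2" "\<theta> 1 \<noteq> \<theta> 3" "\<theta> 2 \<noteq> \<theta> 3"
  shows "defect \<Gamma> \<theta> = 0 \<longleftrightarrow>
      sinh (\<theta> 3 - \<theta> 2) * ((sinh (\<theta> 3 - \<theta> 1))\<^sup>2 - (sinh (\<theta> 2 - \<theta> 1))\<^sup>2) * \<Gamma>$1
    + sinh (\<theta> 3 - \<theta> 1) * ((sinh (\<theta> 3 - \<theta> 2))\<^sup>2 - (sinh (\<theta> 2 - \<theta> 1))\<^sup>2) * \<Gamma>$2
    + sinh (\<theta> 2 - \<theta> 1) * ((sinh (\<theta> 3 - \<theta> 2))\<^sup>2 - (sinh (\<theta> 3 - \<theta> 1))\<^sup>2) * \<Gamma>$3 = 0"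
proof -
  define u v w where "u = sinh (\<theta> 3 - \<theta> 2)" and "v = sinh (\<theta> 3 - \<theta> 1)" and "w = sinh (\<theta> 2 - \<theta> 1)"
  have nz: "u \<noteq> 0" "v \<noteq> 0" "w \<noteq> 0"
    using assms by (simp_all add: u_def v_def w_def)
  have "defect \<Gamma> \<theta> = (- \<Gamma>$2 / w - \<Gamma>$3 / v) * u - (\<Gamma>$1 / w - \<Gamma>$3 / u) * v + (\<Gamma>$1 / v + \<Gamma>$2 / u) * w"
    by (simp add: defect_def normal_speed_3 u_def v_def w_def sinh_diff_swap[of "\<theta> 1" "\<theta> 3"])
  \<comment> \<open>The factor clears all denominators and is nonzero because the parameters are
    distinct.\<close>
  also have "\<dots> * (- u * v * w) = u * (v\<^sup>2 - w\<^sup>2) * \<Gamma>$1 + v * (u\<^sup>2 - w\<^sup>2) * \<Gamma>$2 + w * (u\<^sup>2 - v\<^sup>2) * \<Gamma>$3"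
    using nz by (simp add: field_simps power2_eq_square)
  finally have "defect \<Gamma> \<theta> * (- u * v * w) =
      u * (v\<^sup>2 - w\<^sup>2) * \<Gamma>$1 + v * (u\<^sup>2 - w\<^sup>2) * \<Gamma>$2 + w * (u\<^sup>2 - v\<^sup>2) * \<Gamma>$3" .
  then show ?thesis
    using nz by (metis (no_types) mult_eq_0_iff neg_equal_0_iff_equal u_def v_def w_def)
qed

text \<open>Cramer's rule for vortices 1 and 2 determines \<alpha> and \<beta>; the vanishing
  determinant supplies the equation for vortex 3.\<close>

lemma rigid_velocity_of_defect_eq_0:
  assumes "defect \<Gamma> \<theta> = 0" "\<theta> 1 \<noteq> \<theta> 2"
  obtains \<alpha> \<beta> where "\<And>r. normal_speed \<Gamma> \<theta> r = \<alpha> * sinh (\<theta> r) + \<beta> * cosh (\<theta> r)"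
proof -
  define a where "a = normal_speed \<Gamma> \<theta>"
  define \<alpha> where "\<alpha> = (a 2 * cosh (\<theta> 1) - a 1 * cosh (\<theta> 2)) / sinh (\<theta> 2 - \<theta> 1)"
  define \<beta> where "\<beta> = (a 1 * sinh (\<theta> 2) - a 2 * sinh (\<theta> 1)) / sinh (\<theta> 2 - \<theta> 1)"
  have nz: "sinh (\<theta> 2 - \<theta> 1) \<noteq> 0"
    using assms by simp
  have "sinh (\<theta> 2 - \<theta> 1) * a r = sinh (\<theta> 2 - \<theta> 1) * (\<alpha> * sinh (\<theta> r) + \<beta> * cosh (\<theta> r))" for r
  proof -
    have "sinh (\<theta> 2 - \<theta> 1) * (\<alpha> * sinh (\<theta> r) + \<beta> * cosh (\<theta> r)) =
        (sinh (\<theta> 2 - \<theta> 1) * \<alpha>) * sinh (\<theta> r) + (sinh (\<theta> 2 - \<theta> 1) * \<beta>) * cosh (\<theta> r)"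
      by (simp add: distrib_left mult.assoc)
    also have "\<dots> = a 2 * sinh (\<theta> r - \<theta> 1) - a 1 * sinh (\<theta> r - \<theta> 2)"
      using nz by (simp add: \<alpha>_def \<beta>_def) (simp add: sinh_diff algebra_simps)
    \<comment> \<open>For r = 1 and r = 2 this is immediate; for r = 3 it is exactly the vanishing
      of the defect.\<close>
    also have "\<dots> = sinh (\<theta> 2 - \<theta> 1) * a r"
      using assms(1) exhaust_3[of r]
      by (auto simp: defect_def sinh_diff_swap[of "\<theta> 1"] sinh_diff_swap[of "\<theta> 2" "\<theta> 3"] algebra_simps
          simp flip: a_def)
    finally show ?thesis ..
  qed
  with nz have "\<And>r. a r = \<alpha> * sinh (\<theta> r) + \<beta> * cosh (\<theta> r)"
    by simp
  then show thesis
    using that unfolding a_def by blast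
qed

section \<open>The causal type of the momentum\<close>

lemma momentum_timelike_ordered:
  fixes G1 G2 G3 t1 t2 t3 :: real
  assumes "t1 < t2" "t2 < t3"
    and eq: "sinh (t3 - t2) * ((sinh (t3 - t1))\<^sup>2 - (sinh (t2 - t1))\<^sup>2) * G1
    + sinh (t3 - t1) * ((sinh (t3 - t2))\<^sup>2 - (sinh (t2 - t1))\<^sup>2) * G2
    + sinh (t2 - t1) * ((sinh (t3 - t2))\<^sup>2 - (sinh (t3 - t1))\<^sup>2) * G3 = 0"
  defines "m \<equiv> G1 * cosh t1 + G2 * cosh t2 + G3 * cosh t3"
    and "n \<equiv> G1 * sinh t1 + G2 * sinh t2 + G3 * sinh t3"
  shows "m = 0 \<and> n = 0 \<or> n\<^sup>2 < m\<^sup>2"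
proof -
  define u v w where "u = sinh (t3 - t2)" and "v = sinh (t3 - t1)" and "w = sinh (t2 - t1)"
  have pos: "0 < u" "0 < w" "u < v" "w < v"
    using assms by (auto simp: u_def v_def w_def)
  then have pos2: "u\<^sup>2 < v\<^sup>2" "w\<^sup>2 < v\<^sup>2"
    by (auto intro: power_strict_mono)
  \<comment> \<open>The middle point is a positive combination of the outer ones, so that
    \<open>\<mu>\<close> is \<open>p\<close> times the first point plus \<open>q\<close> times the last one.\<close>
  define p q where "p = G1 + G2 * u / v" and "q = G3 + G2 * w / v"
  have X2: "cosh t2 = (u * cosh t1 + w * cosh t3) / v" "sinh t2 = (u * sinh t1 + w * sinh t3) / v"
    using pos by (simp_all add: field_simps) (simp_all add: u_def v_def w_def sinh_diff algebra_simps)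
  have mn: "m = p * cosh t1 + q * cosh t3" "n = p * sinh t1 + q * sinh t3"
    using pos by (simp_all add: m_def n_def X2 p_def q_def field_simps)
  \<comment> \<open>In the coefficient of \<open>G2\<close> the terms in u^2 w^2 cancel. The outer
    factor v^2 clears the denominators of \<open>p\<close> and \<open>q\<close>.\<close>
  have "v\<^sup>2 * (p * (u * (v\<^sup>2 - w\<^sup>2)) - q * (w * (v\<^sup>2 - u\<^sup>2))) = 
     v\<^sup>2 * (u * (v\<^sup>2 - w\<^sup>2) * G1 + v * (u\<^sup>2 - w\<^sup>2) * G2 + w * (u\<^sup>2 - v\<^sup>2) * G3)"
    using pos by (simp add: p_def q_def field_simps power2_eq_square)
  then have pq: "p * (u * (v\<^sup>2 - w\<^sup>2)) = q * (w * (v\<^sup>2 - u\<^sup>2))"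
    using eq pos by (simp add: u_def v_def w_def)
  \<comment> \<open>Minus the Lorentzian square of p X_1 + q X_3; the cross term carries -<X_1, X_3>
    = cosh (t3 - t1).\<close>
  have "m\<^sup>2 - n\<^sup>2 = p\<^sup>2 * ((cosh t1)\<^sup>2 - (sinh t1)\<^sup>2) + q\<^sup>2 * ((cosh t3)\<^sup>2 - (sinh t3)\<^sup>2) 
     + 2 * (p * q) * (cosh t3 * cosh t1 - sinh t3 * sinh t1)"
    unfolding mn by algebra
  then have sq: "m\<^sup>2 - n\<^sup>2 = p\<^sup>2 + q\<^sup>2 + 2 * (p * q) * cosh (t3 - t1)"
    by (simp add: hyperbolic_pythagoras cosh_diff)
  have A: "0 < u * (v\<^sup>2 - w\<^sup>2)" and B: "0 < w * (v\<^sup>2 - u\<^sup>2)"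
    using pos pos2 by simp_all
  show ?thesis
  proof (cases "p = 0")
    case True
    with pq B have "q = 0"
      by (metis less_irrefl mult_eq_0_iff)
    with True mn show ?thesis
      by simp
  next
    case False
    \<comment> \<open>The two factors are equal by \<open>pq\<close>, so their product is a square.
      Dividing by the positive coefficients leaves the sign of p q.\<close>
    have "0 \<le> (p * (u * (v\<^sup>2 - w\<^sup>2))) * (q * (w * (v\<^sup>2 - u\<^sup>2)))"
      unfolding pq by simp
    also have "\<dots> = (p * q) * ((u * (v\<^sup>2 - w\<^sup>2)) * (w * (v\<^sup>2 - u\<^sup>2)))"
      by simp
    finally have "0 \<le> p * q"
      using mult_pos_pos[OF A B] by (simp add: zero_le_mult_iff)
    then have "0 \<le> 2 * (p * q) * cosh (t3 - t1)"
      by simp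
    with sq False show ?thesis
      by (smt (verit) zero_less_power2 zero_le_power2)
  qed
qed

text \<open>Relabelling the vortices changes the defect by a sign at most, so each of the six orders
  along the geodesic reduces to the ordered case.\<close>

lemma momentum_timelike:
  assumes "\<theta> 1 \<noteq> \<theta> 2" "\<theta> 1 \<noteq> \<theta> 3" "\<theta> 2 \<noteq> \<theta> 3" "defect \<Gamma> \<theta> = 0"
  defines "m \<equiv> \<Sum>r\<in>UNIV. \<Gamma>$r * cosh (\<theta> r)" and "n \<equiv> \<Sum>r\<in>UNIV. \<Gamma>$r * sinh (\<theta> r)"
  shows "m = 0 \<and> n = 0 \<or> n\<^sup>2 < m\<^sup>2"
proof -
  note eq = assms(4)[unfolded defect_eq_0_iff[OF assms(1-3)]]
  note core = momentum_timelike_ordered[of "\<theta> i" "\<theta> j" "\<theta> k" "\<Gamma>$i" "\<Gamma>$j" "\<Gamma>$k" for i j k]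
  note sw = sinh_diff_swap[of "\<theta> 1"] sinh_diff_swap[of "\<theta> 2" "\<theta> 3"]
  consider "\<theta> 1 < \<theta> 2" "\<theta> 2 < \<theta> 3" | "\<theta> 1 < \<theta> 3" "\<theta> 3 < \<theta> 2" | "\<theta> 2 < \<theta> 1" "\<theta> 1 < \<theta> 3"
    | "\<theta> 2 < \<theta> 3" "\<theta> 3 < \<theta> 1" | "\<theta> 3 < \<theta> 1" "\<theta> 1 < \<theta> 2" | "\<theta> 3 < \<theta> 2" "\<theta> 2 < \<theta> 1"
    using assms(1-3) by linarith
  then show ?thesis
    by cases (drule (1) core; use eq in \<open>simp add: m_def n_def sum_3 sw algebra_simps\<close>)+
qed

section \<open>The hyperboloid and the parametrization of its geodesics\<close>

lemma hinner_le_neg_1: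
  assumes "X \<in> hyp_plane" "Y \<in> hyp_plane"
  shows "hinner X Y \<le> - 1" and "hinner X Y = - 1 \<Longrightarrow> X = Y"
proof -
  define h where "h = 1 + X$1 * Y$1 + X$2 * Y$2"
  have X: "(X$3)\<^sup>2 = 1 + (X$1)\<^sup>2 + (X$2)\<^sup>2" "X$3 > 0" and Y: "(Y$3)\<^sup>2 = 1 + (Y$1)\<^sup>2 + (Y$2)\<^sup>2" "Y$3 > 0"
    using assms by (auto simp: hyp_plane_def)
  \<comment> \<open>The reverse Cauchy-Schwarz inequality as an explicit sum of squares, which also
    settles the case of equality.\<close>
  have diff: "(X$3 * Y$3)\<^sup>2 - h\<^sup>2 = (X$1 - Y$1)\<^sup>2 + (X$2 - Y$2)\<^sup>2 + (X$1 * Y$2 - X$2 * Y$1)\<^sup>2"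
    by (simp add: power_mult_distrib X Y h_def) (simp add: power2_eq_square algebra_simps)
  then have "h\<^sup>2 \<le> (X$3 * Y$3)\<^sup>2"
    by (smt (verit) zero_le_power2)
  then have "h \<le> X$3 * Y$3"
    by (rule power2_le_imp_le) (simp add: X(2) Y(2) less_imp_le)
  then show "hinner X Y \<le> - 1"
    by (simp add: hinner_def h_def)
  assume "hinner X Y = - 1"
  then have "h = X$3 * Y$3"
    by (simp add: hinner_def h_def)
  with diff have "(X$1 - Y$1)\<^sup>2 + (X$2 - Y$2)\<^sup>2 + (X$1 * Y$2 - X$2 * Y$1)\<^sup>2 = 0"
    by simp
  then have "X$1 = Y$1" "X$2 = Y$2"
    by (simp_all add: add_nonneg_eq_0_iff)
  moreover have "X$3 = Y$3"
    by (rule power2_eq_imp_eq) (simp_all add: X Y calculation less_imp_le)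
  ultimately show "X = Y"
    by (intro vec3_eqI)
qed

text \<open>Gram-Schmidt turns \<open>Y\<close> into the unit tangent vector \<open>e\<close> at
  \<open>X\<close> pointing towards \<open>Y\<close>. A point c X + d e of the hyperboloid satisfies
  c^2 = d^2 + 1, and the reverse Cauchy-Schwarz inequality gives c >= 1. Hence the parameter is
  \<open>arsinh d\<close>.\<close>

lemma hyp_plane_span_param:
  assumes X: "X \<in> hyp_plane" and Y: "Y \<in> hyp_plane" and "X \<noteq> Y"
  obtains e where "hinner X e = 0" "hinner e e = 1"
    "\<And>Z. Z \<in> hyp_plane \<Longrightarrow> Z \<in> span {X, Y} \<Longrightarrow> \<exists>\<theta>. Z = cosh \<theta> *\<^sub>R X + sinh \<theta> *\<^sub>R e"
proof -
  have XX: "hinner X X = - 1" and YY: "hinner Y Y = - 1"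
    using X Y by (auto simp: hyp_plane_def hinner_def power2_eq_square)
  define h where "h = - hinner X Y"
  have "h > 1"
    using hinner_le_neg_1[OF X Y] \<open>X \<noteq> Y\<close> by (force simp: h_def)
  then have h: "h\<^sup>2 - 1 > 0"
    by simp
  define k where "k = sqrt (h\<^sup>2 - 1)"
  have k: "k > 0" "k\<^sup>2 = h\<^sup>2 - 1"
    using h by (simp_all add: k_def)
  define e where "e = (1 / k) *\<^sub>R (Y - h *\<^sub>R X)"
  have YX: "Y = h *\<^sub>R X + k *\<^sub>R e"
    using k by (simp add: e_def)
  have hh: "hinner X Y = - h" "hinner Y X = - h"
    by (simp_all add: h_def hinner_commute)
  note bil = hinner_bilinear_simps bilinear_lsub[OF bilinear_hinner] bilinear_rsub[OF bilinear_hinner]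
  have Xe: "hinner X e = 0"
    by (simp add: e_def bil XX hh)
  have "hinner e e = (h\<^sup>2 - 1) / k\<^sup>2"
    by (simp add: e_def bil XX YY hh power2_eq_square)
  then have ee: "hinner e e = 1"
    using h k by simp
  have "\<exists>\<theta>. Z = cosh \<theta> *\<^sub>R X + sinh \<theta> *\<^sub>R e" if Z: "Z \<in> hyp_plane" and "Z \<in> span {X, Y}" for Z
  proof -
    obtain a b where "Z = a *\<^sub>R X + b *\<^sub>R Y"
      using \<open>Z \<in> span {X, Y}\<close> unfolding span_breakdown_eq by (auto simp: algebra_simps)
    then have Zeq: "Z = (a + b * h) *\<^sub>R X + (b * k) *\<^sub>R e"
      by (simp add: YX algebra_simps)
    define c d where "c = a + b * h" and "d = b * k"
    have Zcd: "Z = c *\<^sub>R X + d *\<^sub>R e"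
      by (simp add: Zeq c_def d_def)
    have eX: "hinner e X = 0"
      using Xe by (simp add: hinner_commute)
    have "hinner Z Z = - 1" "hinner Z X \<le> - 1"
      using Z hinner_le_neg_1[OF Z X] by (auto simp: hyp_plane_def hinner_def power2_eq_square)
    then have "c * c = d * d + 1" "c \<ge> 1"
      by (simp_all add: Zcd bil XX Xe eX ee)
    then have "cosh (arsinh d) = c"
      by (simp add: cosh_arsinh_real real_sqrt_unique power2_eq_square)
    with Zcd have "Z = cosh (arsinh d) *\<^sub>R X + sinh (arsinh d) *\<^sub>R e"
      by simp
    then show ?thesis ..
  qed
  with Xe ee show thesis
    using that by blast
qed

section \<open>Three vortices in coordinates on one geodesic\<close>

locale geodesic_vortices =
  fixes X :: "real^3^3" and e0 e1 :: "real^3" and \<theta> :: "3 \<Rightarrow> real"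
  assumes frame: "hinner e0 e0 = - 1" "hinner e1 e1 = 1" "hinner e0 e1 = 0"
    and param: "X $ r = cosh (\<theta> r) *\<^sub>R e0 + sinh (\<theta> r) *\<^sub>R e1"
    and X_phase: "X \<in> phase_space"
begin

lemma inj_\<theta>: "r \<noteq> s \<Longrightarrow> \<theta> r \<noteq> \<theta> s"
  using X_phase param[of r] param[of s] by (force simp: phase_space_def)

lemma hinner_points: "hinner (X$r) (X$s) = - cosh (\<theta> r - \<theta> s)"
proof -
  have "hinner e1 e0 = 0"
    using frame by (simp add: hinner_commute)
  then show ?thesis
    by (simp add: param hinner_bilinear_simps frame cosh_diff algebra_simps)
qed

lemma hcross_points: "hcross (X$p) (X$r) = sinh (\<theta> r - \<theta> p) *\<^sub>R hcross e0 e1"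
  by (simp add: param hcross_bilinear_simps hcross_swap[of e1 e0] sinh_diff algebra_simps)

lemma hinner_normal: "hinner (hcross e0 e1) (hcross e0 e1) = 1"
  by (simp add: hinner_hcross_hcross frame)

lemma L_eq: "L X r s = (sinh (\<theta> r - \<theta> s))\<^sup>2"
  by (simp add: L_def hinner_points cosh_square_eq)

text \<open>The denominator cosh^2 - 1 = sinh^2 cancels the factor sinh of the cross product, and
  all cross products share the normal direction.\<close>

lemma vortex_field_eq: "vortex_field \<Gamma> X $ r = (normal_speed \<Gamma> \<theta> r / pi) *\<^sub>R hcross e0 e1"
proof -
  have "\<Gamma>$p *\<^sub>R ((1 / ((hinner (X$r) (X$p))\<^sup>2 - 1)) *\<^sub>R hcross (X$p) (X$r)) =
      (\<Gamma>$p / sinh (\<theta> r - \<theta> p)) *\<^sub>R hcross e0 e1" for p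
    by (simp add: hinner_points hcross_points cosh_square_eq) (simp add: power2_eq_square)
  then show ?thesis
    unfolding vortex_field_def normal_speed_def vec_lambda_beta
    by (simp only: scaleR_sum_left[symmetric] scaleR_scaleR) simp
qed

text \<open>\<theta> is an arc length parameter, so metric betweenness becomes an order relation
  between real numbers.\<close>

lemma hdist_points: "hdist (X$r) (X$s) = \<bar>\<theta> r - \<theta> s\<bar>"
  unfolding hdist_def hinner_points by (metis abs_ge_zero arcosh_cosh_real cosh_real_abs minus_minus)

lemma defect_eq_0_iff_L:
  assumes "hbetween (X$1) (X$2) (X$3)"
  shows "defect \<Gamma> \<theta> = 0 \<longleftrightarrow>
      sqrt (L X 2 3) * (L X 1 3 - L X 1 2) * \<Gamma>$1
    + sqrt (L X 1 3) * (L X 2 3 - L X 1 2) * \<Gamma>$2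
    + sqrt (L X 1 2) * (L X 2 3 - L X 1 3) * \<Gamma>$3 = 0"
proof -
  have ne: "\<theta> 1 \<noteq> \<theta> 2" "\<theta> 1 \<noteq> \<theta> 3" "\<theta> 2 \<noteq> \<theta> 3"
    by (simp_all add: inj_\<theta>)
  have "\<bar>\<theta> 1 - \<theta> 3\<bar> = \<bar>\<theta> 1 - \<theta> 2\<bar> + \<bar>\<theta> 2 - \<theta> 3\<bar>"
    using assms by (simp add: hbetween_def hdist_points)
  with ne have "\<theta> 1 < \<theta> 2 \<and> \<theta> 2 < \<theta> 3 \<or> \<theta> 3 < \<theta> 2 \<and> \<theta> 2 < \<theta> 1"
    by (smt (verit))
  \<comment> \<open>\<sigma> is the orientation of the geodesic. Betweenness gives the three
    differences one common sign, so replacing each sqrt L by a signed sinh changes the condition by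
    the factor \<sigma> only.\<close>
  then obtain \<sigma> :: real where "\<sigma> \<noteq> 0" and
    \<sigma>: "\<bar>sinh (\<theta> 3 - \<theta> 2)\<bar> = \<sigma> * sinh (\<theta> 3 - \<theta> 2)" "\<bar>sinh (\<theta> 3 - \<theta> 1)\<bar> = \<sigma> * sinh (\<theta> 3 - \<theta> 1)"
      "\<bar>sinh (\<theta> 2 - \<theta> 1)\<bar> = \<sigma> * sinh (\<theta> 2 - \<theta> 1)"
  proof (elim disjE)
    assume "\<theta> 1 < \<theta> 2 \<and> \<theta> 2 < \<theta> 3"
    then show ?thesis
      by (intro that[of 1]) simp_all
  next
    assume "\<theta> 3 < \<theta> 2 \<and> \<theta> 2 < \<theta> 1"
    then show ?thesis
      by (intro that[of "- 1"]) simp_all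
  qed
  have L: "L X 2 3 = (sinh (\<theta> 3 - \<theta> 2))\<^sup>2" "L X 1 3 = (sinh (\<theta> 3 - \<theta> 1))\<^sup>2"
    "L X 1 2 = (sinh (\<theta> 2 - \<theta> 1))\<^sup>2"
    unfolding L_eq by (subst sinh_diff_swap, simp)+
  have "sqrt (L X 2 3) * (L X 1 3 - L X 1 2) * \<Gamma>$1
      + sqrt (L X 1 3) * (L X 2 3 - L X 1 2) * \<Gamma>$2
      + sqrt (L X 1 2) * (L X 2 3 - L X 1 3) * \<Gamma>$3 =
      \<sigma> * (sinh (\<theta> 3 - \<theta> 2) * ((sinh (\<theta> 3 - \<theta> 1))\<^sup>2 - (sinh (\<theta> 2 - \<theta> 1))\<^sup>2) * \<Gamma>$1
      + sinh (\<theta> 3 - \<theta> 1) * ((sinh (\<theta> 3 - \<theta> 2))\<^sup>2 - (sinh (\<theta> 2 - \<theta> 1))\<^sup>2) * \<Gamma>$2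
      + sinh (\<theta> 2 - \<theta> 1) * ((sinh (\<theta> 3 - \<theta> 2))\<^sup>2 - (sinh (\<theta> 3 - \<theta> 1))\<^sup>2) * \<Gamma>$3)"
    unfolding L real_sqrt_abs \<sigma> by (simp only: distrib_left mult.assoc)
  then show ?thesis
    unfolding defect_eq_0_iff[OF ne] using \<open>\<sigma> \<noteq> 0\<close> by (simp only: mult_eq_0_iff simp_thms)
qed

section \<open>Necessity: differentiating the triple product\<close>

lemma defect_eq_0_of_relative_equilibrium:
  assumes "relative_equilibrium \<Gamma> X"
  shows "defect \<Gamma> \<theta> = 0"
proof -
  \<comment> \<open>The ordinary determinant of the three positions, since the sign in
    \<open>hcross\<close> cancels the one in \<open>hinner\<close>.\<close>
  define T where "T = (\<lambda>Y :: real^3^3. hinner (hcross (Y$1) (Y$2)) (Y$3))"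
  define N where "N = hcross e0 e1"
  obtain I \<phi> where sol: "vortex_solution \<Gamma> X I \<phi>" and orb: "\<phi> ` I \<subseteq> sl2_orbit X"
    using assms by (auto simp: relative_equilibrium_def vortex_trajectory_def)
  then have I: "open I" "0 \<in> I" and \<phi>0: "\<phi> 0 = X"
    and "(\<phi> has_vector_derivative vortex_field \<Gamma> (\<phi> 0)) (at 0)"
    by (auto simp: vortex_solution_def)
  then have \<phi>': "(\<phi> has_vector_derivative vortex_field \<Gamma> X) (at 0)"
    by simp
  have TX: "T X = 0"
  proof -
    have "hinner (hcross e0 e1) e0 = 0" "hinner (hcross e0 e1) e1 = 0"
      by (simp_all add: hinner_def algebra_simps)
    then show ?thesis
      unfolding T_def hcross_points by (simp add: param[of 3] hinner_bilinear_simps)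
  qed
  have T\<phi>: "T (\<phi> t) = 0" if "t \<in> I" for t
  proof -
    obtain g where "g \<in> SL2" "\<phi> t = (\<chi> r. sl2_act g (X$r))"
      using orb \<open>t \<in> I\<close> unfolding sl2_orbit_def by blast
    then show ?thesis
      using TX by (simp add: T_def hcross_sl2_act hinner_sl2_act)
  qed
  define V where "V = vortex_field \<Gamma> X"
  have nth': "((\<lambda>t. \<phi> t $ r) has_vector_derivative V $ r) (at 0)" for r
    unfolding V_def by (rule bounded_linear.has_vector_derivative[OF bounded_linear_vec_nth \<phi>'])
  note hcross' = bounded_bilinear.has_vector_derivative[OF bilinear_hcross[unfolded bilinear_conv_bounded_bilinear]]
  note hinner' = bounded_bilinear.has_vector_derivative[OF bilinear_hinner[unfolded bilinear_conv_bounded_bilinear]]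
  have "((\<lambda>t. T (\<phi> t)) has_real_derivative
      hinner (hcross (V$1) (X$2)) (X$3) + hinner (hcross (X$1) (V$2)) (X$3)
      + hinner (hcross (X$1) (X$2)) (V$3)) (at 0)"
    unfolding T_def has_real_derivative_iff_has_vector_derivative
    using hinner'[OF hcross'[OF nth'[of 1] nth'[of 2]] nth'[of 3]]
    by (simp add: \<phi>0 hinner_bilinear_simps algebra_simps)
  \<comment> \<open>Cyclic symmetry moves each velocity into the last slot. There it is paired with
    a multiple of the unit normal to which it is parallel.\<close>
  moreover have "hinner (hcross (V$1) (X$2)) (X$3) + hinner (hcross (X$1) (V$2)) (X$3)
      + hinner (hcross (X$1) (X$2)) (V$3) = 
      hinner (hcross (X$2) (X$3)) (V$1) + hinner (hcross (X$3) (X$1)) (V$2)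
      + hinner (hcross (X$1) (X$2)) (V$3)"
    by (simp add: hinner_def algebra_simps)
  moreover have "\<dots> = defect \<Gamma> \<theta> / pi"
    by (simp add: V_def vortex_field_eq hcross_points hinner_bilinear_simps hinner_normal defect_def field_simps)
  ultimately have "((\<lambda>t. T (\<phi> t)) has_real_derivative defect \<Gamma> \<theta> / pi) (at 0)"
    by simp
  moreover have "((\<lambda>t. T (\<phi> t)) has_real_derivative 0) (at 0)"
    by (rule has_field_derivative_transform_within_open[OF DERIV_const I])
      (simp add: T\<phi>)
  ultimately have "defect \<Gamma> \<theta> / pi = 0"
    by (rule DERIV_unique)
  then show ?thesis
    by simp
qed

section \<open>Sufficiency: motion along a one-parameter subgroup\<close>

lemma rigid_motion_of_defect_eq_0:
  assumes "defect \<Gamma> \<theta> = 0"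
  obtains \<xi> where "\<And>r. vortex_field \<Gamma> X $ r = hcross \<xi> (X$r)"
proof -
  have "\<theta> 1 \<noteq> \<theta> 2"
    by (simp add: inj_\<theta>)
  then obtain \<alpha> \<beta> where \<alpha>\<beta>: "\<And>r. normal_speed \<Gamma> \<theta> r = \<alpha> * sinh (\<theta> r) + \<beta> * cosh (\<theta> r)"
    using rigid_velocity_of_defect_eq_0[OF assms] by metis
  \<comment> \<open>With N = \<open>hcross e0 e1\<close>, crossing \<open>e0\<close> with X_r gives
    sinh t_r N, and crossing \<open>e1\<close> with X_r gives -cosh t_r N. This fixes the
    coefficients of \<xi>.\<close>
  have "vortex_field \<Gamma> X $ r = hcross ((\<alpha> / pi) *\<^sub>R e0 - (\<beta> / pi) *\<^sub>R e1) (X$r)" for r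
    unfolding vortex_field_eq \<alpha>\<beta>
    by (simp add: param hcross_bilinear_simps bilinear_lsub[OF bilinear_hcross] hcross_swap[of e1 e0] 
        add_divide_distrib algebra_simps)
  then show thesis
    by (rule that)
qed

end

lemma relative_equilibrium_of_rigid_motion:
  assumes X: "X \<in> phase_space" and V: "\<And>r. vortex_field \<Gamma> X $ r = hcross \<xi> (X$r)"
  shows "relative_equilibrium \<Gamma> X"
proof -
  define \<kappa> where "\<kappa> = hinner \<xi> \<xi>"
  obtain c s :: "real \<Rightarrow> real" where
    c': "\<And>t. (c has_real_derivative - (- \<kappa> / 4) * s t) (at t)" and
    s': "\<And>t. (s has_real_derivative c t) (at t)" and
    0: "c 0 = 1" "s 0 = 0" and cs: "\<And>t. (c t)\<^sup>2 + (- \<kappa> / 4) * (s t)\<^sup>2 = 1"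
    using generator_coefficients[of "- \<kappa> / 4"] by metis
  define W1 where "W1 = (\<chi> r. hcross \<xi> (X$r))"
  define W2 where "W2 = (\<chi> r. hcross \<xi> (hcross \<xi> (X$r)))"
  define \<phi> where "\<phi> = (\<lambda>t. X + (c t * s t) *\<^sub>R W1 + ((s t)\<^sup>2 / 2) *\<^sub>R W2)"
  \<comment> \<open>\<xi> is fixed because \<open>hcross \<xi> \<xi> = 0\<close> kills both
    correction terms of Rodrigues' formula. Equivariance then gives the field along \<phi> the same
    generator \<xi>.\<close>
  have act: "\<exists>g\<in>SL2. \<phi> t = (\<chi> r. sl2_act g (X$r)) \<and> sl2_act g \<xi> = \<xi>" for t
  proof -
    have *: "(c t)\<^sup>2 - hinner \<xi> \<xi> / 4 * (s t)\<^sup>2 = 1"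
      using cs[of t] by (simp add: \<kappa>_def)
    show ?thesis
      using rodrigues_sl2_act[OF *] bilinear_rzero[OF bilinear_hcross]
      by (intro bexI[of _ "c t *\<^sub>R mat 1 - (s t / 2) *\<^sub>R to_mat \<xi>"]) (simp_all add: \<phi>_def W1_def W2_def vec_eq_iff)
  qed
  have phase: "\<phi> t \<in> phase_space" for t
    using act[of t] sl2_act_phase_space[OF _ X] by force
  have field: "vortex_field \<Gamma> (\<phi> t) $ r = hcross \<xi> (\<phi> t $ r)" for t r
  proof -
    obtain g where g: "g \<in> SL2" "\<phi> t = (\<chi> r. sl2_act g (X$r))" "sl2_act g \<xi> = \<xi>"
      using act by blast
    then have "vortex_field \<Gamma> (\<phi> t) $ r = sl2_act g (hcross \<xi> (X$r))"
      by (simp add: vortex_field_sl2_act V)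
    also have "\<dots> = hcross \<xi> (\<phi> t $ r)"
      using g by (simp flip: hcross_sl2_act)
    finally show ?thesis .
  qed
  have deriv: "(\<phi> has_vector_derivative vortex_field \<Gamma> (\<phi> t)) (at t)" for t
  proof -
    have S': "((\<lambda>t. c t * s t) has_real_derivative 1 + \<kappa> * ((s t)\<^sup>2 / 2)) (at t)"
      by (rule DERIV_cong[OF DERIV_mult[OF c' s']])
        (use cs[of t] in \<open>simp add: power2_eq_square algebra_simps\<close>)
    have C': "((\<lambda>t. (s t)\<^sup>2 / 2) has_real_derivative c t * s t) (at t)"
      by (rule derivative_eq_intros s' refl | simp)+
    have "(\<phi> has_vector_derivative (1 + \<kappa> * ((s t)\<^sup>2 / 2)) *\<^sub>R W1 + (c t * s t) *\<^sub>R W2) (at t)"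
      unfolding \<phi>_def
      by (rule has_vector_derivative_eq_rhs, (rule derivative_intros S' C')+) simp
    \<comment> \<open>With A = \<open>hcross \<xi>\<close>, the relation A^3 = \<kappa> A folds the
      cubic term of A \<phi> into the coefficient of \<open>W1\<close>.\<close>
    also have "(1 + \<kappa> * ((s t)\<^sup>2 / 2)) *\<^sub>R W1 + (c t * s t) *\<^sub>R W2 = vortex_field \<Gamma> (\<phi> t)"
      by (subst vec_eq_iff, intro allI, unfold field)
        (simp add: \<phi>_def W1_def W2_def hcross_bilinear_simps hcross_rodrigues \<kappa>_def algebra_simps)
    finally show ?thesis .
  qed
  have "vortex_solution \<Gamma> X UNIV \<phi>"
    using phase deriv 0 by (simp add: vortex_solution_def \<phi>_def vec_eq_iff)
  \<comment> \<open>A solution on the whole real line has no proper extension, so it is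
    maximal.\<close>
  then have "vortex_trajectory \<Gamma> X UNIV \<phi>"
    by (auto simp: vortex_trajectory_def)
  moreover have "\<phi> ` UNIV \<subseteq> sl2_orbit X"
    using act by (force simp: sl2_orbit_def)
  ultimately show ?thesis
    using X unfolding relative_equilibrium_def by blast
qed

section \<open>From a common geodesic to coordinates, and the final criterion\<close>

lemma geodesic_vorticesE:
  assumes X: "X \<in> phase_space" and "on_common_geodesic X"
  obtains e0 e1 \<theta> where "geodesic_vortices X e0 e1 \<theta>"
proof -
  obtain P where P: "subspace P" "dim P = 2" "\<And>r. X$r \<in> hyp_plane" "\<And>r. X$r \<in> P"
    using assms by (auto simp: on_common_geodesic_def geodesic_def)
  have ne: "X$1 \<noteq> X$2"
    using X by (simp add: phase_space_def)
  obtain e where e: "hinner (X$1) e = 0" "hinner e e = 1" and param: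
    "\<And>Z. Z \<in> hyp_plane \<Longrightarrow> Z \<in> span {X$1, X$2} \<Longrightarrow> \<exists>\<theta>. Z = cosh \<theta> *\<^sub>R X$1 + sinh \<theta> *\<^sub>R e"
    using hyp_plane_span_param[OF P(3) P(3) ne] by metis
  have norm: "hinner (X$r) (X$r) = - 1" for r
    using P(3)[of r] by (simp add: hyp_plane_def hinner_def power2_eq_square)
  \<comment> \<open>A line through the origin meets the upper sheet at most once, so two distinct
    points are linearly independent.\<close>
  have "X$1 \<notin> span {X$2}"
  proof
    assume "X$1 \<in> span {X$2}"
    then obtain k where k: "X$1 = k *\<^sub>R X$2"
      by (auto simp: span_singleton)
    with norm[of 1] norm[of 2] have "k * k = 1"
      by (simp add: hinner_bilinear_simps)
    moreover have "X$1$3 > 0" "X$2$3 > 0"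
      using P(3) by (simp_all add: hyp_plane_def)
    then have "k > 0"
      by (simp add: k zero_less_mult_iff)
    ultimately have "k = 1"
      by (auto simp: square_eq_1_iff)
    with k ne show False
      by simp
  qed
  moreover have "X$2 \<noteq> 0"
    using norm[of 2] by (auto simp: hinner_def)
  ultimately have "independent {X$1, X$2}"
    using ne by (simp add: independent_insert)
  then have "dim {X$1, X$2} = 2"
    using ne by (simp add: dim_eq_card_independent)
  \<comment> \<open>By dimension, vortices 1 and 2 span the whole plane of the geodesic, so the
    parametrization built from them also reaches vortex 3.\<close>
  then have "span {X$1, X$2} = span P"
    using P by (intro dim_eq_span) auto
  then have "span {X$1, X$2} = P"
    using P(1) by (simp add: span_eq_iff)
  then have "\<forall>r. \<exists>\<theta>. X$r = cosh \<theta> *\<^sub>R X$1 + sinh \<theta> *\<^sub>R e"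
    using param P by blast
  then obtain \<theta> where "\<And>r. X$r = cosh (\<theta> r) *\<^sub>R X$1 + sinh (\<theta> r) *\<^sub>R e"
    by metis
  then have "geodesic_vortices X (X$1) e \<theta>"
    using e X norm by unfold_locales
  then show thesis
    by (rule that)
qed

theorem theorem5:
  fixes \<Gamma> :: "real^3"
  assumes "\<And>r. \<Gamma>$r \<noteq> 0"
  shows "(\<forall>X :: real^3^3. X \<in> phase_space \<and> on_common_geodesic X \<and> hbetween (X$1) (X$2) (X$3) \<longrightarrow>
            (relative_equilibrium \<Gamma> X \<longleftrightarrow>
               sqrt (L X 2 3) * (L X 1 3 - L X 1 2) * \<Gamma>$1
             + sqrt (L X 1 3) * (L X 2 3 - L X 1 2) * \<Gamma>$2
             + sqrt (L X 1 2) * (L X 2 3 - L X 1 3) * \<Gamma>$3 = 0))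
       \<and> (\<forall>X :: real^3^3. geodesic_relative_equilibrium \<Gamma> X \<longrightarrow>
            momentum \<Gamma> X = 0 \<or> elliptic (momentum \<Gamma> X))"
proof (intro conjI allI impI; (elim conjE)?)
  fix X :: "real^3^3"
  assume X: "X \<in> phase_space" "on_common_geodesic X" and between: "hbetween (X$1) (X$2) (X$3)"
  from X obtain e0 e1 \<theta> where "geodesic_vortices X e0 e1 \<theta>"
    by (rule geodesic_vorticesE)
  then interpret geodesic_vortices X e0 e1 \<theta> .
  have "relative_equilibrium \<Gamma> X \<longleftrightarrow> defect \<Gamma> \<theta> = 0"
    using defect_eq_0_of_relative_equilibrium rigid_motion_of_defect_eq_0
      relative_equilibrium_of_rigid_motion[OF X(1)] by metis
  with defect_eq_0_iff_L[OF between, of \<Gamma>]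
  show "relative_equilibrium \<Gamma> X \<longleftrightarrow>
      sqrt (L X 2 3) * (L X 1 3 - L X 1 2) * \<Gamma>$1
    + sqrt (L X 1 3) * (L X 2 3 - L X 1 2) * \<Gamma>$2
    + sqrt (L X 1 2) * (L X 2 3 - L X 1 3) * \<Gamma>$3 = 0"
    by simp
next
  fix X :: "real^3^3"
  assume "geodesic_relative_equilibrium \<Gamma> X"
  then have req: "relative_equilibrium \<Gamma> X" and X: "X \<in> phase_space" "on_common_geodesic X"
    by (auto simp: geodesic_relative_equilibrium_def relative_equilibrium_def)
  from X obtain e0 e1 \<theta> where "geodesic_vortices X e0 e1 \<theta>"
    by (rule geodesic_vorticesE)
  then interpret geodesic_vortices X e0 e1 \<theta> .
  define m n where "m = (\<Sum>r\<in>UNIV. \<Gamma>$r * cosh (\<theta> r))" and "n = (\<Sum>r\<in>UNIV. \<Gamma>$r * sinh (\<theta> r))"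
  \<comment> \<open>The momentum stays in the plane of the geodesic, where being elliptic means that
    the coefficient of the timelike vector \<open>e0\<close> dominates.\<close>
  have \<mu>: "momentum \<Gamma> X = m *\<^sub>R e0 + n *\<^sub>R e1"
    by (simp add: momentum_def param m_def n_def scaleR_sum_left sum.distrib scaleR_add_right)
  have "hinner e1 e0 = 0"
    using frame by (simp add: hinner_commute)
  then have "hinner (momentum \<Gamma> X) (momentum \<Gamma> X) = n\<^sup>2 - m\<^sup>2"
    by (simp add: \<mu> hinner_bilinear_simps frame power2_eq_square)
  then have "elliptic (momentum \<Gamma> X) \<longleftrightarrow> n\<^sup>2 < m\<^sup>2"
    by (simp add: elliptic_def hinner_def power2_eq_square) linarith
  with \<mu> momentum_timelike[OF _ _ _ defect_eq_0_of_relative_equilibrium[OF req]] inj_\<theta>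
  show "momentum \<Gamma> X = 0 \<or> elliptic (momentum \<Gamma> X)"
    by (auto simp: m_def n_def)
qed

end
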